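(* Let $n\ge 2$. The number of parking functions of $1,\ldots,n$ for which the second spot is lucky is \[ \sum_{i=1}^nq_n(i,2)=\tfrac34(n+1)^{n-1}-\tfrac14(n-1)^{n-1}. \]
   Context: There are $n$ spots labeled $1,\ldots,n$ in order along a one-way street, and $n$ cars entering one after another, car $i$ having preference $a_i\in\{1,\ldots,n\}$. Each car drives to its preferred spot and parks there if it is available; otherwise it moves forward and parks in the first available later spot, if any (if none, it fails to park). A parking function of $1,\ldots,n$ is a sequence of preferences $(a_1,\ldots,a_n)$ such that all $n$ cars are able to park. A car is lucky if it parks in its preferred spot; a spot is lucky if the car that parks in it prefers that spot. For $1\le i,j\le n$, $q_n(i,j)$ denotes the number of parking functions of $1,\ldots,n$ in which the $i$-th car prefers the $j$-th spot and the $i$-th car is lucky. *)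

theory Defs
  imports Complex_Main
begin

text \<open>Preference sequences are lists, so the preference of car \<open>i\<close> (cars are numbered from 1)
  is \<open>ps ! (i - 1)\<close>.\<close>

text \<open>The spot taken by a car preferring spot \<open>a\<close> on a street with spots \<open>1, \<dots>, n\<close> of which
  those in \<open>T\<close> are already taken; \<open>None\<close> if the car fails to park.\<close>

definition park_car :: "nat \<Rightarrow> nat set \<Rightarrow> nat \<Rightarrow> nat option" where
  "park_car n T a =
     (if \<exists>s. a \<le> s \<and> s \<le> n \<and> s \<notin> T then Some (LEAST s. a \<le> s \<and> s \<le> n \<and> s \<notin> T) else None)"

fun park_from :: "nat \<Rightarrow> nat set \<Rightarrow> nat list \<Rightarrow> nat option list" where
  "park_from n T [] = []"
| "park_from n T (a # ps) =
     (let r = park_car n T a in r # park_from n (T \<union> set_option r) ps)"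

definition parked_at :: "nat \<Rightarrow> nat list \<Rightarrow> nat \<Rightarrow> nat option" where
  "parked_at n ps i = park_from n {} ps ! (i - 1)"

definition preference :: "nat list \<Rightarrow> nat \<Rightarrow> nat" where
  "preference ps i = ps ! (i - 1)"

definition parking_function :: "nat \<Rightarrow> nat list \<Rightarrow> bool" where
  "parking_function n ps \<longleftrightarrow>
     length ps = n \<and> set ps \<subseteq> {1..n} \<and> (\<forall>i\<in>{1..n}. parked_at n ps i \<noteq> None)"

definition lucky_car :: "nat \<Rightarrow> nat list \<Rightarrow> nat \<Rightarrow> bool" where
  "lucky_car n ps i \<longleftrightarrow> parked_at n ps i = Some (preference ps i)"

definition lucky_spot :: "nat \<Rightarrow> nat list \<Rightarrow> nat \<Rightarrow> bool" where
  "lucky_spot n ps s \<longleftrightarrow> (\<exists>i\<in>{1..n}. parked_at n ps i = Some s \<and> preference ps i = s)"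

definition q :: "nat \<Rightarrow> nat \<Rightarrow> nat \<Rightarrow> nat" where
  "q n i j = card {ps. parking_function n ps \<and> preference ps i = j \<and> lucky_car n ps i}"

end

theory Submission
  imports Defs "HOL-Library.Sublist"
begin

text \<open>In a parking function, whether spot 2 is lucky depends only on the subword of preferences
  1 and 2: spot 2 is unlucky iff this subword starts with 1, 1. Rewriting that subword arbitrarily
  produces a parking function unless the subword consists of 2s only. As the subword has length at
  least 2, exactly a quarter of the rewritten sequences start with 1, 1. Hence four times the number of
  unlucky parking functions is the number \<open>(n + 1) ^ (n - 1)\<close> of all parking functions plus the
  number of those that avoid 2; collapsing the unused spot makes the latter the prime parking
  functions, of which there are \<open>(n - 1) ^ (n - 1)\<close>. Both counts are instances of the cycle lemma
  for rational parking functions.\<close>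

section \<open>The cycle lemma\<close>

definition below :: "nat \<Rightarrow> nat list \<Rightarrow> nat" where
  "below j xs = length (filter (\<lambda>x. x < j) xs)"

lemma below_simps [simp]:
  "below j [] = 0"
  "below j (x # xs) = of_bool (x < j) + below j xs"
  by (auto simp: below_def)

lemma below_le_length: "below j xs \<le> length xs"
  by (simp add: below_def)

lemma below_0 [simp]: "below 0 xs = 0"
  by (simp add: below_def)

lemma below_mono: "i \<le> j \<Longrightarrow> below i xs \<le> below j xs"
  by (induction xs) auto

lemma below_eq_length_iff: "below m xs = length xs \<longleftrightarrow> set xs \<subseteq> {..<m}"
proof (induction xs)
  case (Cons x xs)
  then show ?case using below_le_length[of m xs] by auto
qed simp

lemma below_eq_length: "set xs \<subseteq> {..<m} \<Longrightarrow> below m xs = length xs"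
  by (simp add: below_eq_length_iff)

lemma below_map:
  assumes "\<And>x. x \<in> set xs \<Longrightarrow> f x < j \<longleftrightarrow> x < k"
  shows "below j (map f xs) = below k xs"
  using assms by (induction xs) auto

definition words :: "nat \<Rightarrow> nat \<Rightarrow> nat list set" where
  "words m L = {xs. set xs \<subseteq> {..<m} \<and> length xs = L}"

lemma finite_words: "finite (words m L)"
  and card_words: "card (words m L) = m ^ L"
  unfolding words_def by (simp_all add: finite_lists_length_eq card_lists_length_eq)

text \<open>For coprime \<open>m\<close> and \<open>L\<close> these are the rational parking functions; \<open>m = L + 1\<close> gives the
  parking functions and \<open>m = L - 1\<close> the prime ones, with preferences counted from 0.\<close>

definition ballot :: "nat \<Rightarrow> nat \<Rightarrow> nat list set" where
  "ballot m L = {xs \<in> words m L. \<forall>j\<in>{0<..<m}. L * j < m * below j xs}"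

text \<open>Rotation of the alphabet \<open>{..<m}\<close> downwards by \<open>t\<close>. Adding
  \<open>m\<close> first keeps the subtraction on naturals from truncating.\<close>

definition shift :: "nat \<Rightarrow> nat \<Rightarrow> nat list \<Rightarrow> nat list" where
  "shift m t xs = map (\<lambda>x. (x + m - t) mod m) xs"

lemma mod_shift:
  fixes x m t :: nat
  assumes "x < m" "t < m"
  shows "(x + m - t) mod m = (if x < t then x + m - t else x - t)"
proof (cases "x < t")
  case False
  then have "x + m - t = (x - t) + m" using assms by linarith
  then have "(x + m - t) mod m = x - t" using assms by (simp only: mod_add_self2) simp
  with False show ?thesis by simp
qed (use assms in auto)

text \<open>A letter lands below \<open>j\<close> iff it lies in the cyclic interval of length
  \<open>j\<close> starting at \<open>t\<close>; the second case is the interval wrapping past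
  \<open>m\<close>. The term \<open>below t xs\<close> stands on the left to avoid
  subtraction.\<close>

lemma below_shift:
  assumes "set xs \<subseteq> {..<m}" "t < m" "j \<le> m"
  shows "below j (shift m t xs) + below t xs =
    (if t + j \<le> m then below (t + j) xs else length xs + below (t + j - m) xs)"
  using assms(1)
proof (induction xs)
  case (Cons x xs)
  then have "x < m" by simp
  then show ?case using Cons assms(2,3) by (auto simp: shift_def mod_shift)
qed (simp add: shift_def)

lemma bij_betw_shift:
  assumes "t < m"
  shows "bij_betw (shift m t) (words m L) (words m L)"
proof -
  have "inj_on (shift m t) (words m L)"
  proof (rule inj_onI)
    fix xs ys assume *: "xs \<in> words m L" "ys \<in> words m L" "shift m t xs = shift m t ys"
    have "inj_on (\<lambda>x. (x + m - t) mod m) {..<m}"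
      by (rule inj_onI) (use assms in \<open>auto simp: mod_shift split: if_splits\<close>)
    then have "inj_on (\<lambda>x. (x + m - t) mod m) (set xs \<union> set ys)"
      by (rule inj_on_subset) (use * in \<open>auto simp: words_def\<close>)
    with *(3) show "xs = ys" unfolding shift_def by (rule map_inj_on)
  qed
  moreover have "shift m t ` words m L \<subseteq> words m L"
    using assms by (auto simp: words_def shift_def)
  ultimately show ?thesis
    by (simp add: bij_betw_def endo_inj_surj finite_words)
qed

text \<open>\<open>T\<close> is the height of a closed walk, \<open>T 0 = T m = 0\<close>, and
  rotating the letters by \<open>t\<close> restarts this walk at \<open>t\<close>. The ballot
  condition then asks the walk to stay strictly above its height at \<open>t\<close>.\<close>

lemma shift_in_ballot_iff:
  assumes "xs \<in> words m L" "t < m"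
  defines "T \<equiv> \<lambda>j. int m * int (below j xs) - int L * int j"
  shows "shift m t xs \<in> ballot m L \<longleftrightarrow> (\<forall>u\<in>{..<m} - {t}. T t < T u)"
proof -
  have xs: "set xs \<subseteq> {..<m}" "length xs = L" using assms(1) by (auto simp: words_def)
  have [simp]: "T m = 0" "T 0 = 0" using xs by (simp_all add: T_def below_eq_length)
  \<comment> \<open>\<open>w j\<close> is \<open>t + j\<close> modulo \<open>m\<close>, the point of
    the original walk that the restarted walk reaches after \<open>j\<close> steps.\<close>
  define w where "w j = (if t + j < m then t + j else t + j - m)" for j
  have height: "int m * int (below j (shift m t xs)) - int L * int j = T (w j) - T t" if "j < m" for j
  proof -
    have b: "int (below j (shift m t xs)) =
      (if t + j \<le> m then int (below (t + j) xs) else int L + int (below (t + j - m) xs)) - int (below t xs)"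
      using below_shift[OF xs(1) assms(2), of j] that xs(2) by (auto split: if_splits)
    consider "t + j < m" | "t + j = m" | "t + j > m" by linarith
    then show ?thesis
    proof cases
      case 1
      then show ?thesis unfolding b by (simp add: w_def T_def algebra_simps)
    next
      case 2
      then have "int L * int m = int L * int t + int L * int j" by (simp flip: distrib_left of_nat_add)
      moreover have "below m xs = L" using xs by (simp add: below_eq_length)
      ultimately show ?thesis unfolding b using 2 by (simp add: w_def T_def algebra_simps)
    next
      case 3
      then have "int (t + j - m) = int t + int j - int m" by simp
      then show ?thesis unfolding b using 3 by (simp add: w_def T_def algebra_simps)
    qed
  qed
  have "shift m t xs \<in> words m L"
    using bij_betw_shift[OF assms(2)] assms(1) by (auto simp: bij_betw_def)
  then have "shift m t xs \<in> ballot m L \<longleftrightarrow>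
      (\<forall>j\<in>{0<..<m}. int L * int j < int m * int (below j (shift m t xs)))"
    by (simp add: ballot_def flip: of_nat_mult)
  also have "\<dots> \<longleftrightarrow> (\<forall>j\<in>{0<..<m}. T t < T (w j))"
    using height by (intro ball_cong refl) force
  also have "\<dots> \<longleftrightarrow> (\<forall>u\<in>w ` {0<..<m}. T t < T u)" by simp
  also have "w ` {0<..<m} = {..<m} - {t}"
  proof
    show "w ` {0<..<m} \<subseteq> {..<m} - {t}" using assms(2) by (auto simp: w_def)
    show "{..<m} - {t} \<subseteq> w ` {0<..<m}"
    proof
      fix u assume u: "u \<in> {..<m} - {t}"
      show "u \<in> w ` {0<..<m}"
      proof (cases "t < u")
        case True
        then show ?thesis using u by (intro image_eqI[of _ _ "u - t"]) (auto simp: w_def)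
      next
        case False
        then show ?thesis using u assms(2)
          by (intro image_eqI[of _ _ "u + m - t"]) (auto simp: w_def)
      qed
    qed
  qed
  finally show ?thesis .
qed

text \<open>The heights \<open>T\<close> are pairwise incongruent modulo \<open>m\<close>, so their minimum is unique.\<close>

lemma ex1_shift_in_ballot:
  assumes "coprime L m" "m > 0" "xs \<in> words m L"
  shows "\<exists>!t. t < m \<and> shift m t xs \<in> ballot m L"
proof -
  define T where "T j = int m * int (below j xs) - int L * int j" for j
  have inj: "a = b" if "a < m" "b < m" "T a = T b" for a b
  proof -
    have "int L * (int a - int b) = int m * (int (below a xs) - int (below b xs))"
      using that(3) by (simp add: T_def algebra_simps)
    then have "int m dvd int L * (int a - int b)" by simp
    then have "int m dvd int a - int b"
      using assms(1) by (simp add: coprime_dvd_mult_right_iff coprime_commute)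
    then have "int a mod int m = int b mod int m" by (simp add: mod_eq_dvd_iff)
    with that show "a = b" by simp
  qed
  have "\<exists>t. t < m \<and> (\<forall>u<m. T t \<le> T u)"
    using ex_min_if_finite[of "T ` {..<m}"] assms(2) by (fastforce simp: not_less)
  then obtain t where "t < m" "\<forall>u<m. T t \<le> T u" by blast
  with inj have "\<forall>u\<in>{..<m} - {t}. T t < T u" by (force simp: order_less_le)
  moreover have "s = t" if "s < m" "\<forall>u\<in>{..<m} - {s}. T s < T u" for s
    using that \<open>t < m\<close> \<open>\<forall>u<m. T t \<le> T u\<close> by (metis Diff_iff lessThan_iff not_less singletonD)
  moreover have "shift m s xs \<in> ballot m L \<longleftrightarrow> (\<forall>u\<in>{..<m} - {s}. T s < T u)" if "s < m" for s
    unfolding T_def by (rule shift_in_ballot_iff[OF assms(3) that])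
  ultimately show ?thesis using \<open>t < m\<close> by blast
qed

text \<open>Double counting of the pairs of a word and a rotation \<open>t\<close> taking it into
  \<open>ballot m L\<close>: each of the \<open>m ^ L\<close> words admits exactly one
  \<open>t\<close>, and each of the \<open>m\<close> rotations is a bijection, hence contributes
  \<open>card (ballot m L)\<close> pairs.\<close>

theorem card_ballot:
  assumes "coprime L m" "m > 0" "L > 0"
  shows "card (ballot m L) = m ^ (L - 1)"
proof -
  have sub: "ballot m L \<subseteq> words m L" by (auto simp: ballot_def)
  have "m ^ L = (\<Sum>xs\<in>words m L. 1)" by (simp add: card_words)
  also have "\<dots> = (\<Sum>xs\<in>words m L. card {t \<in> {..<m}. shift m t xs \<in> ballot m L})"
  proof (rule sum.cong[OF refl])
    fix xs assume "xs \<in> words m L"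
    from ex1_shift_in_ballot[OF assms(1,2) this]
    obtain t where "t < m \<and> shift m t xs \<in> ballot m L"
        "\<forall>u. u < m \<and> shift m u xs \<in> ballot m L \<longrightarrow> u = t"
      by (elim ex1E) metis
    then have "{t \<in> {..<m}. shift m t xs \<in> ballot m L} = {t}" by blast
    then show "1 = card {t \<in> {..<m}. shift m t xs \<in> ballot m L}" by simp
  qed
  also have "\<dots> = (\<Sum>t<m. card {xs \<in> words m L. shift m t xs \<in> ballot m L})"
    unfolding card_eq_sum
    by (rule sum.swap_restrict[OF finite_words finite_lessThan])
  also have "\<dots> = (\<Sum>t<m. card (ballot m L))"
  proof (rule sum.cong[OF refl])
    fix t assume "t \<in> {..<m}"
    then have bij: "bij_betw (shift m t) (words m L) (words m L)" by (simp add: bij_betw_shift)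
    then have img: "shift m t ` {xs \<in> words m L. shift m t xs \<in> ballot m L} = ballot m L"
      using sub by (auto simp: bij_betw_def)
    have inj: "inj_on (shift m t) {xs \<in> words m L. shift m t xs \<in> ballot m L}"
      using bij_betw_imp_inj_on[OF bij] by (rule inj_on_subset) auto
    show "card {xs \<in> words m L. shift m t xs \<in> ballot m L} = card (ballot m L)"
      using card_image[OF inj] unfolding img by (rule sym)
  qed
  finally have "m * m ^ (L - 1) = m * card (ballot m L)"
    using assms(3) by (cases L) simp_all
  then show ?thesis using assms(2) by simp
qed

section \<open>Parking functions\<close>

lemma park_car_SomeD:
  assumes "park_car n T a = Some s"
  shows "a \<le> s" "s \<le> n" "s \<notin> T" "\<And>r. a \<le> r \<Longrightarrow> r < s \<Longrightarrow> r \<in> T"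
proof -
  let ?P = "\<lambda>s. a \<le> s \<and> s \<le> n \<and> s \<notin> T"
  have ex: "\<exists>s. ?P s" and s: "s = (LEAST s. ?P s)"
    using assms by (auto simp: park_car_def split: if_splits)
  have P: "?P s" unfolding s using ex by (rule LeastI_ex)
  then show "a \<le> s" "s \<le> n" "s \<notin> T" by auto
  show "r \<in> T" if "a \<le> r" "r < s" for r
    using not_less_Least[of r ?P] that P unfolding s[symmetric] by auto
qed

lemma park_car_eq_None_iff: "park_car n T a = None \<longleftrightarrow> {a..n} \<subseteq> T"
  by (auto simp: park_car_def)

lemma park_car_free: "a \<le> n \<Longrightarrow> a \<notin> T \<Longrightarrow> park_car n T a = Some a"
  by (auto simp: park_car_def intro!: Least_equality)

lemma length_park_from [simp]: "length (park_from n T ps) = length ps"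
  by (induction n T ps rule: park_from.induct) (simp_all add: Let_def)

text \<open>A Hall-type criterion: cars preferring \<open>j\<close> or later can only use the free
  spots from \<open>j\<close> on. The occupied set \<open>T\<close> stays general for the induction
  over the cars.\<close>

lemma parks_iff_room:
  "None \<notin> set (park_from n T ps) \<longleftrightarrow>
    (\<forall>j. length (filter (\<lambda>x. j \<le> x) ps) \<le> card ({j..n} - T))"
proof (induction ps arbitrary: T)
  case (Cons a ps)
  show ?case
  proof (cases "park_car n T a")
    case None
    \<comment> \<open>A car that fails to park violates the criterion at its own preference.\<close>
    then have empty: "{a..n} - T = {}" by (simp add: park_car_eq_None_iff)
    have "\<not> length (filter (\<lambda>x. a \<le> x) (a # ps)) \<le> card ({a..n} - T)"
      unfolding empty by simp
    then show ?thesis using None by (auto simp: Let_def simp del: filter.simps)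
  next
    case (Some s)
    note s = park_car_SomeD[OF Some]
    let ?l = "\<lambda>j. length (filter (\<lambda>x. j \<le> x) ps)"
    have room: "card ({j..n} - T) = card ({j..n} - insert s T) + of_bool (j \<le> s)" for j
    proof (cases "j \<le> s")
      case True
      then have "{j..n} - T = insert s ({j..n} - insert s T)" using s by auto
      then have "card ({j..n} - T) = card (insert s ({j..n} - insert s T))" by (rule arg_cong)
      also have "\<dots> = Suc (card ({j..n} - insert s T))" by (rule card_insert_disjoint) auto
      finally show ?thesis using True by simp
    next
      case False
      then have "{j..n} - T = {j..n} - insert s T" by auto
      then have "card ({j..n} - T) = card ({j..n} - insert s T)" by (rule arg_cong)
      then show ?thesis using False by simp
    qed
    have "(\<forall>j. ?l j \<le> card ({j..n} - insert s T)) \<longleftrightarrow>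
          (\<forall>j. ?l j + of_bool (j \<le> a) \<le> card ({j..n} - T))" (is "?A \<longleftrightarrow> ?B")
    proof
      assume ?A
      then have "?l j + of_bool (j \<le> a) \<le> card ({j..n} - insert s T) + of_bool (j \<le> s)" for j
        using s(1) by (intro add_mono) auto
      then show ?B by (simp add: room)
    next
      assume B: ?B
      show ?A
      proof
        fix j
        show "?l j \<le> card ({j..n} - insert s T)"
        \<comment> \<open>For \<open>a < j \<le> s\<close> the car uses up a spot without being
          counted on the left. All spots from \<open>a\<close> up to \<open>j\<close> are taken, so
          the bound at \<open>a\<close>, where the car is counted, supplies the missing
          unit.\<close>
        proof (cases "a < j \<and> j \<le> s")
          case True
          have "card ({j..n} - T) = card ({a..n} - T)"
            using True s by (intro arg_cong[where f = card]) (force simp: not_le)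
          moreover have "?l a + 1 \<le> card ({a..n} - T)" using B[rule_format, of a] by simp
          moreover have "?l j \<le> ?l a"
            using True by (induction ps) auto
          ultimately show ?thesis using room[of j] True by simp
        next
          case False
          moreover have "?l j + of_bool (j \<le> a) \<le> card ({j..n} - insert s T) + of_bool (j \<le> s)"
            using B by (simp only: room)
          ultimately show ?thesis using s(1) by (cases "j \<le> a"; cases "j \<le> s") simp_all
        qed
      qed
    qed
    moreover have "length (filter (\<lambda>x. j \<le> x) (a # ps)) = ?l j + of_bool (j \<le> a)" for j by simp
    ultimately show ?thesis
      using Some Cons.IH[of "insert s T"] by (simp add: Let_def del: filter.simps)
  qed
qed simp

lemma length_filter_ge: "length (filter (\<lambda>x. j \<le> x) ps) + below j ps = length ps"
  by (induction ps) auto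

lemma Ball_parked_at:
  assumes "length ps = n"
  shows "(\<forall>i\<in>{1..n}. parked_at n ps i \<noteq> None) \<longleftrightarrow> None \<notin> set (park_from n {} ps)"
proof -
  have "(\<forall>i\<in>{1..n}. parked_at n ps i \<noteq> None) \<longleftrightarrow> (\<forall>i<n. park_from n {} ps ! i \<noteq> None)"
    unfolding parked_at_def by (auto dest!: bspec[of _ _ "Suc _"])
  then show ?thesis using assms by (auto simp: in_set_conv_nth)
qed

text \<open>The complement of \<open>parks_iff_room\<close> on the empty street:
  \<open>n - below j ps\<close> cars must fit into the \<open>Suc n - j\<close> spots from
  \<open>j\<close> on. The index is then moved by one.\<close>

lemma parking_function_iff:
  "parking_function n ps \<longleftrightarrow>
    length ps = n \<and> set ps \<subseteq> {1..n} \<and> (\<forall>j\<in>{1..n}. j \<le> below (Suc j) ps)"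
proof (cases "length ps = n \<and> set ps \<subseteq> {1..n}")
  case True
  have "parking_function n ps \<longleftrightarrow> (\<forall>j. n - below j ps \<le> Suc n - j)"
  proof -
    have "length (filter (\<lambda>x. j \<le> x) ps) = n - below j ps" for j
      using True length_filter_ge[of j ps] by simp
    then show ?thesis
      using True Ball_parked_at[of ps n] by (simp add: parking_function_def parks_iff_room)
  qed
  also have "\<dots> \<longleftrightarrow> (\<forall>j\<in>{1..n}. j \<le> below (Suc j) ps)"
  proof
    assume *: "\<forall>j. n - below j ps \<le> Suc n - j"
    show "\<forall>j\<in>{1..n}. j \<le> below (Suc j) ps"
    proof
      fix j assume "j \<in> {1..n}"
      then show "j \<le> below (Suc j) ps"
        using *[rule_format, of "Suc j"] by auto
    qed
  next
    assume *: "\<forall>j\<in>{1..n}. j \<le> below (Suc j) ps"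
    show "\<forall>j. n - below j ps \<le> Suc n - j"
    proof
      fix j
      \<comment> \<open>At \<open>j \<le> 1\<close> there is room for all \<open>n\<close> cars;
        beyond \<open>Suc n\<close> the right side truncates to 0, but then every preference is
        below \<open>j\<close>.\<close>
      consider "j \<le> 1" | i where "j = Suc i" "i \<in> {1..n}" | "j > Suc n"
        by (cases j) fastforce+
      then show "n - below j ps \<le> Suc n - j"
      proof cases
        case 2
        then show ?thesis using *[rule_format, of i] by simp
      next
        case 3
        have "below (Suc n) ps = n" using True by (subst below_eq_length) auto
        then show ?thesis using below_mono[of "Suc n" j ps] 3 by simp
      qed auto
    qed
  qed
  finally show ?thesis using True by blast
qed (auto simp: parking_function_def)

lemma finite_parking_functions: "finite {ps. parking_function n ps}"
  by (rule finite_subset[OF _ finite_lists_length_eq[of "{1..n}" n]])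
    (auto simp: parking_function_def)

section \<open>Counting all parking functions and those avoiding preference 2\<close>

lemma card_parking_functions:
  assumes "n > 0"
  shows "card {ps. parking_function n ps} = (n + 1) ^ (n - 1)"
proof -
  \<comment> \<open>For \<open>m = n + 1\<close> and \<open>L = n\<close> the ballot threshold
    \<open>n * j / (n + 1)\<close> lies strictly between \<open>j - 1\<close> and
    \<open>j\<close>.\<close>
  have ineq: "n * j < Suc n * b \<longleftrightarrow> j \<le> b" if "0 < j" "j \<le> n" for j b :: nat
  proof
    assume "j \<le> b"
    then have "n * j \<le> n * b" "0 < b" using that by (auto intro: mult_le_mono2)
    then show "n * j < Suc n * b" unfolding mult_Suc by linarith
  next
    assume less: "n * j < Suc n * b"
    show "j \<le> b"
    proof (rule ccontr)
      assume "\<not> j \<le> b"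
      then have "n * Suc b \<le> n * j" "b \<le> n" using that by (auto simp del: mult_Suc_right)
      with less show False by simp
    qed
  qed
  have "{ps. parking_function n ps} = map Suc ` ballot (Suc n) n"
  proof (intro equalityI subsetI)
    fix ps assume "ps \<in> {ps. parking_function n ps}"
    then have ps: "length ps = n" "set ps \<subseteq> {1..n}" "\<forall>j\<in>{1..n}. j \<le> below (Suc j) ps"
      by (auto simp: parking_function_iff)
    let ?xs = "map (\<lambda>x. x - 1) ps"
    have le: "1 \<le> x \<and> x \<le> n" if "x \<in> set ps" for x using ps(2) that by auto
    then have "below j ?xs = below (Suc j) ps" for j
      by (intro below_map) fastforce
    moreover have "set ?xs \<subseteq> {..<Suc n}" using le by fastforce
    ultimately have "?xs \<in> ballot (Suc n) n"
      using ps(1,3) ineq by (auto simp: ballot_def words_def simp del: mult_Suc)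
    moreover have "map Suc ?xs = ps"
      unfolding map_map by (rule map_idI) (use le in fastforce)
    ultimately show "ps \<in> map Suc ` ballot (Suc n) n" by (metis imageI)
  next
    fix ps assume "ps \<in> map Suc ` ballot (Suc n) n"
    then obtain xs where xs: "ps = map Suc xs" "xs \<in> ballot (Suc n) n" by blast
    then have len: "length xs = n" by (simp add: ballot_def words_def)
    have many: "j \<le> below j xs" if "0 < j" "j \<le> n" for j
    proof -
      have "n * j < Suc n * below j xs"
        using xs(2) that by (simp add: ballot_def del: mult_Suc)
      then show ?thesis using ineq[OF that] by blast
    qed
    \<comment> \<open>A word over \<open>{..<Suc n}\<close> could use the letter \<open>n\<close>,
      which would become the preference \<open>n + 1\<close>; the condition at \<open>j = n\<close>
      rules it out.\<close>
    have "below n xs = length xs"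
      using many[of n] below_le_length[of n xs] assms len by simp
    then have "set xs \<subseteq> {..<n}" by (simp only: below_eq_length_iff)
    moreover have "below (Suc j) ps = below j xs" for j
      unfolding xs(1) by (rule below_map) simp
    ultimately show "ps \<in> {ps. parking_function n ps}"
      using len many by (auto simp: xs(1) parking_function_iff)
  qed
  then have "card {ps. parking_function n ps} = card (ballot (Suc n) n)"
    by (simp add: card_image inj_on_subset[OF inj_mapI])
  also have "\<dots> = Suc n ^ (n - 1)"
    using assms by (intro card_ballot) auto
  finally show ?thesis by simp
qed

lemma card_parking_functions_avoiding_2:
  assumes "n \<ge> 2"
  shows "card {ps. parking_function n ps \<and> 2 \<notin> set ps} = (n - 1) ^ (n - 1)"
proof -
  define g :: "nat \<Rightarrow> nat" where "g x = (if x = 0 then 1 else x + 2)" for x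
  define h :: "nat \<Rightarrow> nat" where "h x = x - 2" for x
  \<comment> \<open>For \<open>m = n - 1\<close> and \<open>L = n\<close> the threshold
    \<open>n * j / (n - 1)\<close> lies strictly between \<open>j\<close> and \<open>j + 1\<close>:
    one letter more than \<open>j\<close> is required.\<close>
  have ineq: "n * j < (n - 1) * b \<longleftrightarrow> Suc j \<le> b" if "0 < j" "j < n - 1" for j b :: nat
  proof
    assume "Suc j \<le> b"
    then have "(n - 1) * Suc j \<le> (n - 1) * b" by (rule mult_le_mono2)
    moreover have "n * j = (n - 1) * j + j" using assms by (cases n) auto
    ultimately show "n * j < (n - 1) * b" using that by simp
  next
    assume less: "n * j < (n - 1) * b"
    show "Suc j \<le> b"
    proof (rule ccontr)
      assume "\<not> Suc j \<le> b"
      then have "(n - 1) * b \<le> n * j" by (intro mult_le_mono) auto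
      with less show False by simp
    qed
  qed
  have "{ps. parking_function n ps \<and> 2 \<notin> set ps} = map g ` ballot (n - 1) n"
  proof (intro equalityI subsetI)
    fix ps assume "ps \<in> {ps. parking_function n ps \<and> 2 \<notin> set ps}"
    then have ps: "length ps = n" "set ps \<subseteq> {1..n}" "\<forall>j\<in>{1..n}. j \<le> below (Suc j) ps" "2 \<notin> set ps"
      by (auto simp: parking_function_iff)
    have "below j (map h ps) = below (Suc (Suc j)) ps" if "0 < j" for j
      by (rule below_map) (use that in \<open>auto simp: h_def\<close>)
    moreover have "h x < n - 1" if "x \<in> set ps" for x
    proof -
      have "x \<in> {1..n}" using ps(2) that by blast
      then show ?thesis using assms by (auto simp: h_def)
    qed
    ultimately have "map h ps \<in> ballot (n - 1) n"
      using ps ineq by (auto simp: ballot_def words_def)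
    moreover have "map g (map h ps) = ps"
      unfolding map_map
    proof (rule map_idI)
      fix x assume "x \<in> set ps"
      then have "1 \<le> x" "x \<noteq> 2" using ps(2,4) by auto
      then show "(g \<circ> h) x = x" by (auto simp: g_def h_def)
    qed
    ultimately show "ps \<in> map g ` ballot (n - 1) n" by (metis imageI)
  next
    fix ps assume "ps \<in> map g ` ballot (n - 1) n"
    then obtain xs where xs: "ps = map g xs" "set xs \<subseteq> {..<n - 1}" "length xs = n"
        "\<forall>j\<in>{0<..<n - 1}. Suc j \<le> below j xs"
      using ineq by (auto simp: ballot_def words_def)
    have b: "below (Suc (Suc j)) ps = below j xs" if "0 < j" for j
      unfolding xs(1) by (rule below_map) (use that in \<open>auto simp: g_def\<close>)
    have 1: "below 2 ps = below 1 xs"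
      unfolding xs(1) by (rule below_map) (auto simp: g_def)
    have top: "below (n - 1) xs = n" using xs by (simp add: below_eq_length)
    \<comment> \<open>The ballot condition ends at \<open>j = n - 2\<close>; at
      \<open>j = n - 1\<close> the bound holds because all \<open>n\<close> letters are below
      \<open>n - 1\<close>.\<close>
    have many: "Suc j \<le> below j xs" if "0 < j" "j < n" for j
      using that xs(4) top by (cases "j = n - 1") auto
    have "j \<le> below (Suc j) ps" if "j \<in> {1..n}" for j
    proof (cases "j = 1")
      case True
      then show ?thesis using 1 many[of 1] assms by (simp add: numeral_2_eq_2)
    next
      case False
      with that obtain i where "j = Suc i" "0 < i" "i < n" by (cases j) auto
      then show ?thesis using b many by simp
    qed
    moreover have "set ps \<subseteq> {1..n}" "2 \<notin> set ps"
      using xs(2) assms by (auto simp: xs(1) g_def)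
    ultimately show "ps \<in> {ps. parking_function n ps \<and> 2 \<notin> set ps}"
      using xs by (auto simp: parking_function_iff)
  qed
  moreover have "inj_on (map g) (ballot (n - 1) n)"
    by (rule inj_on_subset[OF inj_mapI]) (auto simp: inj_def g_def)
  ultimately have "card {ps. parking_function n ps \<and> 2 \<notin> set ps} = card (ballot (n - 1) n)"
    by (simp add: card_image)
  also have "\<dots> = (n - 1) ^ (n - 1)"
    using assms by (intro card_ballot coprime_diff_one_right_nat) auto
  finally show ?thesis .
qed

section \<open>Lucky spots\<close>

text \<open>Replaces car numbers by membership in a list of pairs, a form suited to induction along
  the list.\<close>

lemma lucky_spot_iff:
  assumes "length ps = n"
  shows "lucky_spot n ps s \<longleftrightarrow> (Some s, s) \<in> set (zip (park_from n {} ps) ps)"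
proof -
  have "lucky_spot n ps s \<longleftrightarrow> (\<exists>i<n. park_from n {} ps ! i = Some s \<and> ps ! i = s)"
  proof -
    have "{1..n} = Suc ` {..<n}" by (simp add: image_Suc_lessThan)
    then show ?thesis by (auto simp: lucky_spot_def parked_at_def preference_def)
  qed
  then show ?thesis using assms by (auto simp: in_set_zip)
qed

lemma parked_spot_not_taken: "Some s \<in> set (park_from n T ps) \<Longrightarrow> s \<notin> T"
proof (induction ps arbitrary: T)
  case (Cons a ps)
  then consider "park_car n T a = Some s" | "s \<notin> T \<union> set_option (park_car n T a)"
    by (fastforce simp: Let_def)
  then show ?case by cases (auto dest: park_car_SomeD(3))
qed simp

text \<open>Cars preferring later spots never occupy spot 2, so the first car preferring 1 or 2
  takes it; a preference for 1 overflows from the occupied spot 1. No later car can park there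
  again.\<close>

lemma lucky_2_if_1_taken:
  assumes "2 \<le> n" "0 \<notin> set ps" "1 \<in> T" "2 \<notin> T"
  shows "(Some 2, 2) \<in> set (zip (park_from n T ps) ps) \<longleftrightarrow>
    prefix [2] (filter (\<lambda>x. x \<in> {1, 2}) ps)"
  using assms(2-)
proof (induction ps arbitrary: T)
  case (Cons a ps)
  consider "a = 1" | "a = 2" | "a > 2" using Cons.prems(1) by fastforce
  then show ?case
  proof cases
    case 1
    have "2 \<in> {1..n}" using assms(1) by simp
    then have "park_car n T 1 \<noteq> None"
      using Cons.prems(3) by (auto simp only: park_car_eq_None_iff)
    then obtain s where s: "park_car n T 1 = Some s" by blast
    have "s = 2"
      using park_car_SomeD[OF s] Cons.prems
      by (metis One_nat_def Suc_1 le_neq_implies_less less_2_cases_iff less_Suc_eq_le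
          linorder_neqE_nat not_less_eq_eq)
    then show ?thesis using s 1
      by (auto simp: Let_def dest!: set_zip_leftD parked_spot_not_taken)
  next
    case 2
    then show ?thesis using assms(1) Cons.prems park_car_free[of 2 n T] by (simp add: Let_def)
  next
    case 3
    let ?T = "T \<union> set_option (park_car n T a)"
    have "2 \<notin> ?T" using 3 Cons.prems by (auto dest: park_car_SomeD(1))
    then show ?thesis using Cons.IH[of ?T] Cons.prems 3 by (auto simp: Let_def)
  qed
qed simp

text \<open>The first car preferring 1 or 2 decides: with 2 it is lucky at once, with 1 it occupies
  spot 1 and leaves the situation of \<open>lucky_2_if_1_taken\<close>.\<close>

lemma lucky_2_if_free:
  assumes "2 \<le> n" "0 \<notin> set ps" "1 \<notin> T" "2 \<notin> T"
  shows "(Some 2, 2) \<in> set (zip (park_from n T ps) ps) \<longleftrightarrow>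
    prefix [2] (filter (\<lambda>x. x \<in> {1, 2}) ps) \<or> prefix [1, 2] (filter (\<lambda>x. x \<in> {1, 2}) ps)"
  using assms(2-)
proof (induction ps arbitrary: T)
  case (Cons a ps)
  consider "a = 1" | "a = 2" | "a > 2" using Cons.prems(1) by fastforce
  then show ?case
  proof cases
    case 1
    then show ?thesis
      using assms(1) Cons.prems park_car_free[of 1 n T] lucky_2_if_1_taken[of n ps "insert 1 T"]
      by (simp add: Let_def)
  next
    case 2
    then show ?thesis using assms(1) Cons.prems park_car_free[of 2 n T] by (simp add: Let_def)
  next
    case 3
    let ?T = "T \<union> set_option (park_car n T a)"
    have "1 \<notin> ?T" "2 \<notin> ?T" using 3 Cons.prems by (auto dest: park_car_SomeD(1))
    then show ?thesis using Cons.IH[of ?T] Cons.prems 3 by (auto simp: Let_def)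
  qed
qed simp

lemma length_filter_12:
  "0 \<notin> set ps \<Longrightarrow> length (filter (\<lambda>x. x \<in> {1, 2}) ps) = below 3 ps"
  by (induction ps) auto

text \<open>The parking condition at \<open>j = 2\<close> gives the subword length at least 2, so it
  begins with 11, 12, 21 or 22; \<open>lucky_2_if_free\<close> accepts all but the first.\<close>

lemma lucky_spot_2_iff:
  assumes "2 \<le> n" "parking_function n ps"
  shows "lucky_spot n ps 2 \<longleftrightarrow> \<not> prefix [1, 1] (filter (\<lambda>x. x \<in> {1, 2}) ps)"
proof -
  have ps: "length ps = n" "0 \<notin> set ps"
    using assms by (force simp: parking_function_iff)+
  have "2 \<le> below 3 ps"
    using assms by (auto simp: parking_function_iff numeral_3_eq_3 dest: bspec[of _ _ 2])
  define f where "f = filter (\<lambda>x. x \<in> {1, 2}) ps"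
  have "2 \<le> length f" unfolding f_def length_filter_12[OF ps(2)] by fact
  then obtain a b xs where f: "f = a # b # xs"
    by (cases f; cases "tl f") auto
  have "set f \<subseteq> {1, 2}" by (auto simp: f_def)
  then have "a \<in> {1, 2}" "b \<in> {1, 2}" by (auto simp: f)
  moreover have "lucky_spot n ps 2 \<longleftrightarrow> prefix [2] f \<or> prefix [1, 2] f"
    unfolding lucky_spot_iff[OF ps(1)] f_def by (rule lucky_2_if_free) (use assms ps in auto)
  moreover have "prefix [2] f \<longleftrightarrow> a = 2" "prefix [c, d] f \<longleftrightarrow> a = c \<and> b = d" for c d
    by (auto simp: f)
  ultimately have "lucky_spot n ps 2 \<longleftrightarrow> \<not> prefix [1, 1] f"
    by (simp only: insert_iff empty_iff) (elim disjE; simp)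
  then show ?thesis by (simp only: f_def)
qed

section \<open>Rewriting the preferences 1 and 2\<close>

definition merge2 :: "nat \<Rightarrow> nat" where
  "merge2 x = (if x = 2 then 1 else x)"

text \<open>The fibre over \<open>r\<close> arises by independently keeping each 1 of
  \<open>r\<close> or turning it into 2; the prefix \<open>w\<close> fixes the first
  \<open>length w\<close> of these binary choices.\<close>

lemma card_merge2_fibre:
  assumes "2 \<notin> set r" "set w \<subseteq> {1, 2}" "length w \<le> count_list r 1"
  shows "card {ps. map merge2 ps = r \<and> prefix w (filter (\<lambda>x. x \<in> {1, 2}) ps)} =
    2 ^ (count_list r 1 - length w)"
  using assms
proof (induction r arbitrary: w)
  case Nil
  then have "w = []" by simp
  then show ?case by simp
next
  case (Cons x r)
  let ?S = "\<lambda>w r. {ps. map merge2 ps = r \<and> prefix w (filter (\<lambda>x. x \<in> {1, 2}) ps)}"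
  show ?case
  proof (cases "x = 1")
    case False
    then have "?S w (x # r) = Cons x ` ?S w r"
      using Cons.prems by (auto simp: merge2_def map_eq_Cons_conv split: if_splits)
    then show ?thesis using Cons False by (simp add: card_image)
  next
    case True
    show ?thesis
    proof (cases w)
      case Nil
      \<comment> \<open>The induction hypothesis makes the cardinality a power of 2, hence positive,
        and only finite sets have positive \<open>card\<close>.\<close>
      have "finite (?S [] r)" using Cons.IH[of "[]"] Cons.prems
        by (intro card_ge_0_finite) simp
      moreover have "?S [] (x # r) = Cons 1 ` ?S [] r \<union> Cons 2 ` ?S [] r"
        using True by (auto simp: merge2_def map_eq_Cons_conv split: if_splits)
      moreover have "Cons 1 ` ?S [] r \<inter> Cons 2 ` ?S [] r = {}" by auto
      ultimately have "card (?S [] (x # r)) = card (?S [] r) + card (?S [] r)"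
        by (simp add: card_Un_disjoint card_image)
      then show ?thesis using Nil True Cons.IH[of "[]"] Cons.prems by simp
    next
      case (Cons c v)
      then have "c \<in> {1, 2}" using Cons.prems by simp
      then have "?S w (x # r) = Cons c ` ?S v r"
        using True Cons by (auto simp: merge2_def map_eq_Cons_conv split: if_splits)
      then show ?thesis using Cons True Cons.IH[of v] Cons.prems by (simp add: card_image)
    qed
  qed
qed

text \<open>Every 1 must have become a 2, which leaves a single rewriting.\<close>

lemma merge2_fibre_without_1:
  assumes "2 \<notin> set r"
  shows "{ps. map merge2 ps = r \<and> 1 \<notin> set ps} = {map (\<lambda>x. if x = 1 then 2 else x) r}"
proof (intro equalityI subsetI)
  let ?f = "\<lambda>x::nat. if x = 1 then 2 else x"
  fix ps assume "ps \<in> {ps. map merge2 ps = r \<and> 1 \<notin> set ps}"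
  then have r: "r = map merge2 ps" and "1 \<notin> set ps" by auto
  then have "map ?f r = ps"
    unfolding r map_map by (intro map_idI) (auto simp: merge2_def)
  then show "ps \<in> {map ?f r}" by simp
next
  let ?f = "\<lambda>x::nat. if x = 1 then 2 else x"
  fix ps assume ps: "ps \<in> {map ?f r}"
  have "map merge2 (map ?f r) = r"
    unfolding map_map by (rule map_idI) (use assms in \<open>auto simp: merge2_def\<close>)
  then show "ps \<in> {ps. map merge2 ps = r \<and> 1 \<notin> set ps}" using ps by auto
qed

lemma below_merge2: "j \<noteq> 2 \<Longrightarrow> below j (map merge2 ps) = below j ps"
  by (rule below_map) (auto simp: merge2_def)

lemma count_list_1_merge2:
  "0 \<notin> set ps \<Longrightarrow> count_list (map merge2 ps) 1 = below 3 ps"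
  by (induction ps) (auto simp: merge2_def)

lemma set_merge2_subset_iff: "2 \<le> n \<Longrightarrow> set (map merge2 ps) \<subseteq> {1..n} \<longleftrightarrow> set ps \<subseteq> {1..n}"
  by (induction ps) (auto simp: merge2_def)

text \<open>Merging affects only the condition at spot 1. For the merged sequence it follows from
  the condition at spot 2; for the original one it says that some car prefers 1.\<close>

lemma parking_function_merge2_iff:
  assumes "2 \<le> n"
  shows "parking_function n ps \<longleftrightarrow> parking_function n (map merge2 ps) \<and> 1 \<in> set ps"
proof (cases "length ps = n \<and> set ps \<subseteq> {1..n}")
  case True
  have "{1..n} = insert 1 {2..n}" using assms by auto
  then have pf: "parking_function n qs \<longleftrightarrow> 1 \<le> below 2 qs \<and> (\<forall>j\<in>{2..n}. j \<le> below (Suc j) qs)"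
    if "length qs = n" "set qs \<subseteq> {1..n}" for qs
    using that by (simp add: parking_function_iff numeral_2_eq_2)
  have one: "1 \<le> below 2 ps \<longleftrightarrow> 1 \<in> set ps"
  proof -
    have "0 \<notin> set ps" using True by auto
    then show ?thesis by (induction ps) auto
  qed
  have "below 2 (map merge2 ps) = below 3 ps"
    by (rule below_map) (auto simp: merge2_def)
  moreover have "2 \<le> below 3 ps" if "\<forall>j\<in>{2..n}. j \<le> below (Suc j) ps"
    using bspec[OF that, of 2] assms by (simp add: numeral_3_eq_3)
  ultimately show ?thesis
    using True assms pf[of ps] pf[of "map merge2 ps"] set_merge2_subset_iff[OF assms, of ps] one
    by (auto simp: below_merge2)
next
  case False
  then show ?thesis
    using set_merge2_subset_iff[OF assms, of ps] by (auto simp: parking_function_def)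
qed

text \<open>Sorts the sequences by their merged image, which always avoids 2. \<open>Q\<close> is
  left free to count fibres under three conditions: subword beginning 1, 1; no restriction; no
  1.\<close>

lemma card_by_merge2:
  assumes "2 \<le> n"
  shows "card {ps. parking_function n (map merge2 ps) \<and> Q ps} =
    (\<Sum>r | parking_function n r \<and> 2 \<notin> set r. card {ps. map merge2 ps = r \<and> Q ps})"
    (is "card ?W = sum _ ?R")
proof -
  have "?W \<subseteq> {ps. set ps \<subseteq> {1..n} \<and> length ps = n}"
    using set_merge2_subset_iff[OF assms] by (auto simp: parking_function_def)
  then have "finite ?W" by (rule finite_subset) (simp add: finite_lists_length_eq)
  moreover have "finite ?R" using finite_parking_functions[of n] by simp
  moreover have "map merge2 ` ?W \<subseteq> ?R" by (auto simp: merge2_def)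
  ultimately have "card ?W = (\<Sum>r\<in>?R. card {ps \<in> ?W. map merge2 ps = r})"
    unfolding card_eq_sum by (rule sum.group[symmetric])
  also have "\<dots> = (\<Sum>r\<in>?R. card {ps. map merge2 ps = r \<and> Q ps})"
    by (intro sum.cong arg_cong[where f = card]) auto
  finally show ?thesis .
qed

lemma card_unlucky:
  assumes "2 \<le> n"
  shows "4 * card {ps. parking_function n ps \<and> \<not> lucky_spot n ps 2} =
    card {ps. parking_function n ps} + card {ps. parking_function n ps \<and> 2 \<notin> set ps}"
proof -
  let ?R = "{r. parking_function n r \<and> 2 \<notin> set r}"
  let ?pre = "\<lambda>w ps. prefix w (filter (\<lambda>x. x \<in> {1, 2}) ps)"
  \<comment> \<open>A subword beginning 1, 1 contains a 1, so the extra condition in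
    \<open>parking_function_merge2_iff\<close> is automatic.\<close>
  have "1 \<in> set ps" if "?pre [1, 1] ps" for ps
    using set_mono_prefix[OF that] by auto
  then have "{ps. parking_function n ps \<and> \<not> lucky_spot n ps 2} =
      {ps. parking_function n (map merge2 ps) \<and> ?pre [1, 1] ps}"
    using lucky_spot_2_iff[OF assms] parking_function_merge2_iff[OF assms] by blast
  then have "4 * card {ps. parking_function n ps \<and> \<not> lucky_spot n ps 2} =
      (\<Sum>r\<in>?R. 4 * card {ps. map merge2 ps = r \<and> ?pre [1, 1] ps})"
    by (simp only: card_by_merge2[OF assms] sum_distrib_left)
  \<comment> \<open>Prescribing \<open>[1, 1]\<close> fixes two of the at least two binary choices,
    a factor of 4 in each fibre; the empty prefix is no restriction.\<close>
  also have "\<dots> = (\<Sum>r\<in>?R. card {ps. map merge2 ps = r \<and> ?pre [] ps})"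
  proof (rule sum.cong[OF refl])
    fix r assume r: "r \<in> ?R"
    then have "map merge2 r = r" by (intro map_idI) (auto simp: merge2_def)
    moreover have "0 \<notin> set r"
      using r by (auto simp: parking_function_iff)
    moreover have "2 \<le> below 3 r"
      using r assms by (auto simp: parking_function_iff numeral_3_eq_3 dest: bspec[of _ _ 2])
    ultimately have "2 \<le> count_list r 1" using count_list_1_merge2[of r] by simp
    then obtain k where "count_list r 1 = 2 + k" using le_Suc_ex by blast
    then show "4 * card {ps. map merge2 ps = r \<and> ?pre [1, 1] ps} =
        card {ps. map merge2 ps = r \<and> ?pre [] ps}"
      using card_merge2_fibre[of r "[1, 1]"] card_merge2_fibre[of r "[]"] r by simp
  qed
  also have "\<dots> = card {ps. parking_function n (map merge2 ps)}"
    using card_by_merge2[OF assms, of "?pre []"] by simp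
  \<comment> \<open>The rewritings that fail to be parking functions are those without 1. There is
    one in each fibre, so they are as many as the parking functions avoiding 2.\<close>
  also have "{ps. parking_function n (map merge2 ps)} =
      {ps. parking_function n ps} \<union> {ps. parking_function n (map merge2 ps) \<and> 1 \<notin> set ps}"
    using parking_function_merge2_iff[OF assms] by blast
  also have "card \<dots> = card {ps. parking_function n ps} +
      card {ps. parking_function n (map merge2 ps) \<and> 1 \<notin> set ps}"
  proof (rule card_Un_disjoint)
    show "finite {ps. parking_function n (map merge2 ps) \<and> 1 \<notin> set ps}"
      by (rule finite_subset[OF _ finite_lists_length_eq[of "{1..n}" n]])
        (use set_merge2_subset_iff[OF assms] in \<open>auto simp: parking_function_def\<close>)
    show "{ps. parking_function n ps} \<inter> {ps. parking_function n (map merge2 ps) \<and> 1 \<notin> set ps} = {}"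
      using parking_function_merge2_iff[OF assms] by blast
  qed (rule finite_parking_functions)
  also have "card {ps. parking_function n (map merge2 ps) \<and> 1 \<notin> set ps} =
      (\<Sum>r\<in>?R. card {ps. map merge2 ps = r \<and> 1 \<notin> set ps})"
    using card_by_merge2[OF assms, of "\<lambda>ps. 1 \<notin> set ps"] .
  also have "\<dots> = (\<Sum>r\<in>?R. 1)"
  proof (rule sum.cong[OF refl])
    fix r assume "r \<in> ?R"
    then have "2 \<notin> set r" by simp
    show "card {ps. map merge2 ps = r \<and> 1 \<notin> set ps} = 1"
      unfolding merge2_fibre_without_1[OF \<open>2 \<notin> set r\<close>] by simp
  qed
  finally show ?thesis by simp
qed

section \<open>Summation over the lucky car and conclusion\<close>

lemma parked_spot_inject:
  assumes "i < length ps" "k < length ps"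
    and "park_from n T ps ! i = Some s" "park_from n T ps ! k = Some s"
  shows "i = k"
  using assms
proof (induction ps arbitrary: T i k)
  case (Cons a ps)
  have "s \<notin> T \<union> set_option (park_car n T a)"
    if "j < length ps" "park_from n (T \<union> set_option (park_car n T a)) ps ! j = Some s" for j
    using that by (metis length_park_from nth_mem parked_spot_not_taken)
  then show ?case
    using Cons by (cases i; cases k) (auto simp: Let_def)
qed simp

text \<open>Splits by the car that makes spot \<open>s\<close> lucky. The classes are disjoint
  because two cars never park in the same spot.\<close>

lemma card_lucky_spot:
  "card {ps. parking_function n ps \<and> lucky_spot n ps s} = (\<Sum>i=1..n. q n i s)"
proof -
  let ?A = "\<lambda>i. {ps. parking_function n ps \<and> preference ps i = s \<and> lucky_car n ps i}"
  have "{ps. parking_function n ps \<and> lucky_spot n ps s} = (\<Union>i\<in>{1..n}. ?A i)"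
    by (auto simp: lucky_spot_def lucky_car_def)
  also have "card \<dots> = (\<Sum>i=1..n. card (?A i))"
  proof (rule card_UN_disjoint)
    show "\<forall>i\<in>{1..n}. finite (?A i)" using finite_parking_functions[of n] by simp
    show "\<forall>i\<in>{1..n}. \<forall>k\<in>{1..n}. i \<noteq> k \<longrightarrow> ?A i \<inter> ?A k = {}"
    proof (intro ballI impI equals0I)
      fix i k ps assume *: "i \<in> {1..n}" "k \<in> {1..n}" "i \<noteq> k" "ps \<in> ?A i \<inter> ?A k"
      then have "i - 1 = k - 1"
        by (intro parked_spot_inject[of _ ps _ n "{}" s])
          (auto simp: lucky_car_def parked_at_def parking_function_def)
      with * show False by auto
    qed
  qed simp
  finally show ?thesis by (simp add: q_def)
qed

theorem theorem3p1:
  fixes n :: nat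
  assumes "n \<ge> 2"
  shows "card {ps. parking_function n ps \<and> lucky_spot n ps 2} = (\<Sum>i=1..n. q n i 2) \<and>
         real (\<Sum>i=1..n. q n i 2) =
           3 / 4 * (real n + 1) ^ (n - 1) - 1 / 4 * (real n - 1) ^ (n - 1)"
proof -
  let ?P = "{ps. parking_function n ps}"
  let ?L = "{ps. parking_function n ps \<and> lucky_spot n ps 2}"
  let ?U = "{ps. parking_function n ps \<and> \<not> lucky_spot n ps 2}"
  have "card ?P = card (?L \<union> ?U)" by (intro arg_cong[where f = card]) auto
  also have "\<dots> = card ?L + card ?U"
    using finite_parking_functions[of n] by (intro card_Un_disjoint) auto
  finally have "real (card ?P) = real (card ?L) + real (card ?U)" by simp
  moreover have "real (4 * card ?U) = real (card ?P + (n - 1) ^ (n - 1))"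
    by (simp only: card_unlucky[OF assms] card_parking_functions_avoiding_2[OF assms])
  then have "4 * real (card ?U) = real (card ?P) + real ((n - 1) ^ (n - 1))"
    by (simp only: of_nat_add of_nat_mult of_nat_numeral)
  moreover have "real (card ?P) = (real n + 1) ^ (n - 1)"
    using card_parking_functions[of n] assms by (simp add: add.commute)
  moreover have "real ((n - 1) ^ (n - 1)) = (real n - 1) ^ (n - 1)"
    using assms by (simp add: of_nat_diff)
  \<comment> \<open>Eliminating \<open>?U\<close> gives four times \<open>card ?L\<close> as three
    times \<open>card ?P\<close> minus \<open>(n - 1) ^ (n - 1)\<close>.\<close>
  ultimately have "real (card ?L) = 3 / 4 * (real n + 1) ^ (n - 1) - 1 / 4 * (real n - 1) ^ (n - 1)"
    by (simp add: field_simps)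
  then show ?thesis by (simp only: card_lucky_spot)
qed

end
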